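(* Suppose $A$ is a bounded linear operator on a complex Hilbert space that is complex symmetric. Then $A$ is posinormal if and only if it is coposinormal.
   Context: A bounded linear operator $A$ on a Hilbert space is complex symmetric if there exists a conjugate-linear, isometric involution $J$ on the space such that $JAJ=A^*$. $A$ is posinormal if there is a positive operator $P$ with $AA^*=A^*PA$ (equivalently, $\operatorname{ran}A\subseteq\operatorname{ran}A^*$, or equivalently $A=A^*T$ for some bounded linear operator $T$); $A$ is coposinormal if $A^*$ is posinormal. *)

theory Defs
  imports "HOL-Analysis.Analysis"
begin

text \<open>
  Complex Hilbert spaces are built on top of the library's real normed spaces: the real scalar
  multiplication is the restriction of the complex one, and the norm (hence the topology and the
  notion of completeness) is the one induced by the inner product.  The inner product is
  linear in its first and conjugate-linear in its second argument.
\<close>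

class complex_vector = real_vector +
  fixes scaleC :: "complex \<Rightarrow> 'a \<Rightarrow> 'a" (infixr "*\<^sub>C" 75)
  assumes scaleC_add_right: "a *\<^sub>C (x + y) = a *\<^sub>C x + a *\<^sub>C y"
    and scaleC_add_left: "(a + b) *\<^sub>C x = a *\<^sub>C x + b *\<^sub>C x"
    and scaleC_scaleC: "a *\<^sub>C b *\<^sub>C x = (a * b) *\<^sub>C x"
    and scaleC_one: "1 *\<^sub>C x = x"
    and scaleR_scaleC: "r *\<^sub>R x = complex_of_real r *\<^sub>C x"

class complex_inner = complex_vector + real_normed_vector +
  fixes cinner :: "'a \<Rightarrow> 'a \<Rightarrow> complex"
  assumes cinner_commute: "cinner x y = cnj (cinner y x)"
    and cinner_add_left: "cinner (x + y) z = cinner x z + cinner y z"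
    and cinner_scaleC_left: "cinner (c *\<^sub>C x) y = c * cinner x y"
    and cinner_ge_zero: "0 \<le> Re (cinner x x)"
    and cinner_eq_zero_iff: "cinner x x = 0 \<longleftrightarrow> x = 0"
    and norm_eq_sqrt_cinner: "norm x = sqrt (Re (cinner x x))"

class chilbert_space = complex_inner + complete_space

text \<open>The scalar field itself is a complex Hilbert space.\<close>

instantiation complex :: chilbert_space
begin

definition scaleC_complex :: "complex \<Rightarrow> complex \<Rightarrow> complex"
  where "scaleC_complex a x = a * x"

definition cinner_complex :: "complex \<Rightarrow> complex \<Rightarrow> complex"
  where "cinner_complex x y = x * cnj y"

instance
  by standard
    (auto simp: scaleC_complex_def cinner_complex_def algebra_simps scaleR_conv_of_real
      cmod_def power2_eq_square)

end

definition bounded_clinear :: "('a::complex_inner \<Rightarrow> 'b::complex_inner) \<Rightarrow> bool"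
  where "bounded_clinear A \<longleftrightarrow> bounded_linear A \<and> (\<forall>c x. A (c *\<^sub>C x) = c *\<^sub>C A x)"

text \<open>
  As for the library's \<^const>\<open>adjoint\<close>, the adjoint is chosen by its defining identity; it exists
  and is unique for bounded operators between Hilbert spaces.
\<close>

definition cadjoint :: "('a::chilbert_space \<Rightarrow> 'b::chilbert_space) \<Rightarrow> 'b \<Rightarrow> 'a"
  where "cadjoint A = (SOME B. \<forall>x y. cinner (A x) y = cinner x (B y))"

definition positive_operator :: "('a::chilbert_space \<Rightarrow> 'a) \<Rightarrow> bool"
  where "positive_operator P \<longleftrightarrow>
    bounded_clinear P \<and> (\<forall>x. cinner (P x) x \<in> \<real> \<and> 0 \<le> Re (cinner (P x) x))"

definition conjugation :: "('a::chilbert_space \<Rightarrow> 'a) \<Rightarrow> bool"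
  where "conjugation J \<longleftrightarrow>
    (\<forall>x y. J (x + y) = J x + J y) \<and> (\<forall>c x. J (c *\<^sub>C x) = cnj c *\<^sub>C J x) \<and>
    (\<forall>x. norm (J x) = norm x) \<and> (\<forall>x. J (J x) = x)"

definition complex_symmetric :: "('a::chilbert_space \<Rightarrow> 'a) \<Rightarrow> bool"
  where "complex_symmetric A \<longleftrightarrow> (\<exists>J. conjugation J \<and> J \<circ> A \<circ> J = cadjoint A)"

definition posinormal :: "('a::chilbert_space \<Rightarrow> 'a) \<Rightarrow> bool"
  where "posinormal A \<longleftrightarrow>
    (\<exists>P. positive_operator P \<and> A \<circ> cadjoint A = cadjoint A \<circ> P \<circ> A)"

definition coposinormal :: "('a::chilbert_space \<Rightarrow> 'a) \<Rightarrow> bool"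
  where "coposinormal A \<longleftrightarrow> posinormal (cadjoint A)"

end

theory Submission
  imports Defs
begin

text \<open>
  Conjugating \<open>A A\<^sup>* = A\<^sup>* P A\<close> by \<open>J\<close> exchanges \<open>A\<close> and \<open>A\<^sup>*\<close> and replaces \<open>P\<close> by the operator
  \<open>J P J\<close>, which is again positive because \<open>\<langle>J x, J y\<rangle> = \<langle>y, x\<rangle>\<close>.  Since the adjoint is a choice,
  its defining identity first has to be secured by the Riesz representation theorem, obtained
  here by minimising \<open>\<parallel>x\<parallel>\<^sup>2 - 2 g x\<close>.
\<close>

subsection \<open>Complex inner products\<close>

lemma cinner_add_right: "cinner x (y + z) = cinner x y + cinner x z"
  by (metis cinner_add_left cinner_commute complex_cnj_add)

lemma Re_cinner_commute: "Re (cinner x y) = Re (cinner y x)"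
  by (metis cinner_commute complex_cnj(1) complex.sel(1) complex.exhaust_sel)

lemma cinner_scaleR_left: "cinner (r *\<^sub>R x) y = of_real r * cinner x y"
  by (simp add: scaleR_scaleC cinner_scaleC_left)

lemma cinner_minus_left: "cinner (- x) y = - cinner x y"
  using cinner_scaleR_left[of "-1" x y] by simp

lemma cinner_right_eqI:
  assumes "\<And>x. cinner x y = cinner x z"
  shows "y = z"
proof -
  have "cinner (y - z) (y - z) = cinner (y - z) y - cinner (y - z) z"
    by (metis cinner_add_right add_diff_cancel_left' diff_add_cancel)
  then show ?thesis
    using assms cinner_eq_zero_iff[of "y - z"] by simp
qed

lemma norm_square_cinner: "(norm x)\<^sup>2 = Re (cinner x x)"
  by (simp add: norm_eq_sqrt_cinner cinner_ge_zero)

lemma norm_square_add: "(norm (x + y))\<^sup>2 = (norm x)\<^sup>2 + 2 * Re (cinner x y) + (norm y)\<^sup>2"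
  using Re_cinner_commute[of x y]
  by (simp add: norm_square_cinner cinner_add_left cinner_add_right)

lemma parallelogram_cinner:
  "(norm (x + y))\<^sup>2 + (norm (x - y))\<^sup>2 = 2 * (norm x)\<^sup>2 + 2 * (norm y)\<^sup>2"
  for x y :: "'a::complex_inner"
  using norm_square_add[of x y] norm_square_add[of "- y" x] Re_cinner_commute[of x y]
  by (simp add: cinner_minus_left)

text \<open>Cauchy-Schwarz follows from the triangle inequality, an axiom of the underlying
  normed-space class, by squaring and cancelling.\<close>

lemma Re_cinner_le: "Re (cinner x y) \<le> norm x * norm y"
proof -
  have "(norm (x + y))\<^sup>2 \<le> (norm x + norm y)\<^sup>2"
    by (intro power_mono norm_triangle_ineq) simp
  then show ?thesis
    unfolding norm_square_add by (simp add: power2_sum)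
qed

lemma abs_Re_cinner_le: "\<bar>Re (cinner x y)\<bar> \<le> norm x * norm y"
  using Re_cinner_le[of x y] Re_cinner_le[of "- x" y] by (simp add: cinner_minus_left abs_if)

lemma bounded_linear_Re_cinner: "bounded_linear (\<lambda>x. Re (cinner x y))"
  by (rule bounded_linear_intro[of _ "norm y"])
    (auto simp: cinner_add_left cinner_scaleR_left abs_Re_cinner_le)

text \<open>Lets complex identities be checked on real parts alone, so that a Riesz theorem for real
  functionals suffices.\<close>

lemma Im_eq_Re_scaleC: "Im (cinner x y) = - Re (cinner (\<i> *\<^sub>C x) y)"
  by (simp add: cinner_scaleC_left)

subsection \<open>The Riesz representation theorem and the adjoint\<close>

lemma quadratic_nonneg_imp_linear_coeff_zero:
  fixes N d :: real
  assumes "N \<ge> 0" and "\<And>t. 0 \<le> t\<^sup>2 * N + 2 * t * d"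
  shows "d = 0"
proof -
  \<comment> \<open>The test point is t = -u; dividing by N + 1 instead of N covers N = 0.\<close>
  define u where "u = d / (N + 1)"
  have d: "d = u * (N + 1)"
    using assms(1) by (simp add: u_def)
  have "0 \<le> (- u)\<^sup>2 * N + 2 * (- u) * d"
    by (rule assms)
  also have "\<dots> = - (u\<^sup>2 * (N + 2))"
    by (simp add: d algebra_simps power2_eq_square)
  finally have "u = 0"
    using assms(1) by (simp add: mult_le_0_iff)
  then show ?thesis
    by (simp add: d)
qed

lemma riesz_Re_cinner:
  fixes g :: "'a::chilbert_space \<Rightarrow> real"
  assumes "bounded_linear g"
  obtains z where "\<And>x. g x = Re (cinner x z)"
proof -
  interpret g: bounded_linear g by fact
  define F where "F x = (norm x)\<^sup>2 - 2 * g x" for x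
  obtain K where K: "\<And>x. norm (g x) \<le> norm x * K"
    using g.bounded by blast
  \<comment> \<open>Completing the square bounds F x below by (norm x - K)^2 - K^2.\<close>
  have F_ge: "F x \<ge> - K\<^sup>2" for x
    using K[of x] zero_le_power2[of "norm x - K"] by (auto simp: F_def power2_diff)
  have bdd: "bdd_below (range F)"
    using F_ge by (auto intro!: bdd_belowI)
  define c where "c = Inf (range F)"
  have c_le: "c \<le> F x" for x
    unfolding c_def using bdd by (simp add: cInf_lower)
  have "\<exists>x. F x < c + 1 / real (Suc n)" for n
    using cInf_lessD[of "range F" "c + 1 / real (Suc n)"] by (auto simp: c_def)
  then obtain s where s: "\<And>n. F (s n) < c + 1 / real (Suc n)"
    by metis
  \<comment> \<open>The g-terms cancel by linearity, leaving the parallelogram law. Since F is at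
    least c at midpoints, a minimising sequence must be Cauchy.\<close>
  have mid: "(norm (x - y))\<^sup>2 = 2 * F x + 2 * F y - 4 * F ((1/2) *\<^sub>R (x + y))" for x y
    using parallelogram_cinner[of x y]
    by (simp add: F_def g.scaleR g.add power_mult_distrib power_divide add_divide_distrib)
  have near: "(norm (s m - s n))\<^sup>2 < 2 / real (Suc m) + 2 / real (Suc n)" for m n
    using mid[of "s m" "s n"] s[of m] s[of n] c_le[of "(1/2) *\<^sub>R (s m + s n)"] by simp
  have "Cauchy s"
  proof (rule metric_CauchyI)
    fix e :: real
    assume "0 < e"
    then obtain M where M: "inverse (real (Suc M)) < e\<^sup>2 / 4"
      using reals_Archimedean[of "e\<^sup>2 / 4"] by auto
    have "dist (s m) (s n) < e" if "M \<le> m" "M \<le> n" for m n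
    proof -
      have "1 / real (Suc m) \<le> 1 / real (Suc M)" "1 / real (Suc n) \<le> 1 / real (Suc M)"
        using that by (auto intro!: divide_left_mono)
      then have "(norm (s m - s n))\<^sup>2 < e\<^sup>2"
        using near[of m n] M by (simp add: inverse_eq_divide)
      then show ?thesis
        using \<open>0 < e\<close> by (simp add: dist_norm power2_less_imp_less)
    qed
    then show "\<exists>M. \<forall>m\<ge>M. \<forall>n\<ge>M. dist (s m) (s n) < e" by blast
  qed
  then obtain z where z: "s \<longlonglongrightarrow> z"
    using Cauchy_convergent convergent_def by blast
  have "(\<lambda>n. F (s n)) \<longlonglongrightarrow> F z"
    unfolding F_def by (intro tendsto_intros g.tendsto z)
  moreover have "(\<lambda>n. c + 1 / real (Suc n)) \<longlonglongrightarrow> c + 0"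
    by (intro tendsto_intros LIMSEQ_Suc lim_1_over_n)
  ultimately have Fz: "F z \<le> c"
    using s by (auto intro: LIMSEQ_le less_imp_le)
  \<comment> \<open>First variation at the minimiser z: F (t x + z) - F z is a quadratic in t that
    is never negative.\<close>
  have "Re (cinner x z) - g x = 0" for x
  proof (rule quadratic_nonneg_imp_linear_coeff_zero[of "(norm x)\<^sup>2"])
    fix t
    have "F z \<le> F (t *\<^sub>R x + z)"
      using Fz c_le order_trans by blast
    then show "0 \<le> t\<^sup>2 * (norm x)\<^sup>2 + 2 * t * (Re (cinner x z) - g x)"
      by (simp add: F_def norm_square_add g.add g.scaleR cinner_scaleR_left
          power_mult_distrib right_diff_distrib)
  qed simp
  then have "g x = Re (cinner x z)" for x
    by (metis eq_iff_diff_eq_0)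
  then show ?thesis
    by (rule that)
qed

lemma cadjoint_exists:
  fixes A :: "'a::chilbert_space \<Rightarrow> 'b::chilbert_space"
  assumes "bounded_clinear A"
  shows "\<exists>B. \<forall>x y. cinner (A x) y = cinner x (B y)"
proof -
  have lin: "bounded_linear A" and hom: "\<And>c x. A (c *\<^sub>C x) = c *\<^sub>C A x"
    using assms by (auto simp: bounded_clinear_def)
  have "\<exists>z. \<forall>x. cinner (A x) y = cinner x z" for y
  proof -
    have "bounded_linear (\<lambda>x. Re (cinner (A x) y))"
      by (rule bounded_linear_compose[OF bounded_linear_Re_cinner lin])
    then obtain z where z: "\<And>x. Re (cinner (A x) y) = Re (cinner x z)"
      using riesz_Re_cinner by blast
    \<comment> \<open>As A commutes with \<i>, the real identity at \<open>\<i> *\<^sub>C x\<close>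
      supplies the imaginary parts.\<close>
    have "cinner (A x) y = cinner x z" for x
      using z[of x] z[of "\<i> *\<^sub>C x"]
      by (simp add: complex_eq_iff Im_eq_Re_scaleC hom)
    then show ?thesis by blast
  qed
  then show ?thesis by metis
qed

lemma cinner_cadjoint:
  assumes "bounded_clinear A"
  shows "cinner (A x) y = cinner x (cadjoint A y)"
  using someI_ex[OF cadjoint_exists[OF assms]] unfolding cadjoint_def by blast

text \<open>B itself witnesses the choice in \<open>cadjoint\<close>, and nondegeneracy of the inner
  product makes the chosen map equal to B. Hence \<open>cadjoint_cadjoint\<close> can apply this to
  \<open>cadjoint A\<close> before anything is known of its boundedness.\<close>

lemma cadjoint_eqI:
  assumes "\<And>x y. cinner (A x) y = cinner x (B y)"
  shows "cadjoint A = B"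
proof -
  have "\<forall>x y. cinner (A x) y = cinner x (cadjoint A y)"
    unfolding cadjoint_def by (rule someI[of _ B]) (simp add: assms)
  then show ?thesis
    using assms by (metis cinner_right_eqI ext)
qed

lemma cadjoint_cadjoint:
  assumes "bounded_clinear A"
  shows "cadjoint (cadjoint A) = A"
  by (rule cadjoint_eqI) (metis assms cinner_cadjoint cinner_commute)

subsection \<open>Conjugations\<close>

text \<open>Polarization: J preserves the norms of x, y and x + y, which determine the real
  part.\<close>

lemma conjugation_Re_cinner:
  assumes "conjugation J"
  shows "Re (cinner (J x) (J y)) = Re (cinner x y)"
proof -
  have "norm (J x + J y) = norm (x + y)" "norm (J x) = norm x" "norm (J y) = norm y"
    using assms by (metis conjugation_def)+
  then show ?thesis
    using norm_square_add[of x y] norm_square_add[of "J x" "J y"] by simp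
qed

lemma conjugation_cinner:
  assumes "conjugation J"
  shows "cinner (J x) (J y) = cinner y x"
proof -
  \<comment> \<open>Conjugate-linearity turns \<i> into -\<i>, which flips the sign of the imaginary
    part.\<close>
  have "J (\<i> *\<^sub>C x) = cnj \<i> *\<^sub>C J x"
    using assms by (auto simp: conjugation_def)
  then have "Im (cinner (J x) (J y)) = - Im (cinner x y)"
    using conjugation_Re_cinner[OF assms, of "\<i> *\<^sub>C x" y] by (simp add: cinner_scaleC_left)
  then have "cinner (J x) (J y) = cnj (cinner x y)"
    by (simp add: complex_eq_iff conjugation_Re_cinner[OF assms])
  then show ?thesis by (metis cinner_commute)
qed

lemma bounded_linear_conjugation:
  assumes "conjugation J"
  shows "bounded_linear J"
  using assms
  by (intro bounded_linear_intro[of J 1]) (auto simp: conjugation_def scaleR_scaleC)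

text \<open>The two conjugate-linear factors compose to a linear map, and the quadratic form at x is
  the conjugate of that of P at J x, hence the same nonnegative real.\<close>

lemma positive_operator_conjugate:
  assumes J: "conjugation J" and P: "positive_operator P"
  shows "positive_operator (J \<circ> P \<circ> J)"
proof -
  have "bounded_linear P"
    using P by (simp add: positive_operator_def bounded_clinear_def)
  then have "bounded_linear (J \<circ> P \<circ> J)"
    unfolding comp_def using bounded_linear_conjugation[OF J]
    by (blast intro: bounded_linear_compose[OF _ bounded_linear_compose, of J P J])
  moreover have "(J \<circ> P \<circ> J) (c *\<^sub>C x) = c *\<^sub>C (J \<circ> P \<circ> J) x" for c x
    using J P by (simp add: positive_operator_def bounded_clinear_def conjugation_def)
  moreover have "cinner ((J \<circ> P \<circ> J) x) x = cnj (cinner (P (J x)) (J x))" for x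
    using conjugation_cinner[OF J, of "P (J x)" "J x"] J cinner_commute[of "J x" "P (J x)"]
    by (simp add: conjugation_def)
  ultimately show ?thesis
    using P by (simp add: positive_operator_def bounded_clinear_def Reals_cnj_iff)
qed

text \<open>B is kept abstract so that the pair (A, B) can be both (A, \<open>cadjoint A\<close>)
  and its swap, one for each direction of the equivalence.\<close>

lemma posinormal_identity_conjugate:
  assumes J: "conjugation J" and B: "B = J \<circ> A \<circ> J" and eq: "A \<circ> B = B \<circ> P \<circ> A"
  shows "B \<circ> A = A \<circ> (J \<circ> P \<circ> J) \<circ> B"
proof
  fix x
  have JJ: "J (J u) = u" for u
    using J by (simp add: conjugation_def)
  have "A (J (A x)) = J (A (J (P (A (J x)))))"
    using fun_cong[OF eq, of "J x"] by (simp add: B JJ)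
  then show "(B \<circ> A) x = (A \<circ> (J \<circ> P \<circ> J) \<circ> B) x"
    by (simp add: B JJ)
qed

theorem proposition5p5:
  fixes A :: "'a::chilbert_space \<Rightarrow> 'a"
  assumes "bounded_clinear A"
    and "complex_symmetric A"
  shows "posinormal A \<longleftrightarrow> coposinormal A"
proof -
  obtain J where J: "conjugation J" and B: "cadjoint A = J \<circ> A \<circ> J"
    using assms(2) by (auto simp: complex_symmetric_def)
  have A: "A = J \<circ> cadjoint A \<circ> J"
    using J by (auto simp: B conjugation_def)
  show ?thesis
    unfolding coposinormal_def posinormal_def cadjoint_cadjoint[OF assms(1)]
    using positive_operator_conjugate[OF J]
      posinormal_identity_conjugate[OF J B] posinormal_identity_conjugate[OF J A]
    by blast
qed

end
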